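(* Let $R>0$ and let $\omega,\sigma\in\mathbb{C}$ with $\Im(\sigma)>0$ and $\Im(\sigma\omega)>0$. Then there exist constants $c_1,c_2>0$, independent of $N$, such that for all $N\in\mathbb{N}$ $$\inf_{u_N\in\tilde{\mathcal X}_N}\left\|h_0(\omega(R+\sigma\,\cdot\,))-u_N\right\|_{L_2(\mathbb{R}_{\ge 0})}\le c_1\left|\frac{1+i\sigma\omega}{1-i\sigma\omega}\right|^{N+1}+c_2\exp\left(-2\,\Re\sqrt{\frac{2R(N+1)}{\sigma}}\right).$$
   Context: $L_2(\mathbb{R}_{\ge 0})$ is the space of complex-valued square integrable functions on $[0,\infty)$. For $n\in\mathbb{N}_0$ let $L_n(x)=\sum_{k=0}^n\binom{n}{k}\frac{(-x)^k}{k!}$ be the Laguerre polynomial and $\phi_n(x)=\exp(-x)L_n(2x)$ the Laguerre function; $\tilde{\mathcal X}_N=\mathrm{span}\{\phi_n: n=0,\ldots,N\}$ (complex span). The function $h_0(z)=-\frac{i}{z}\exp(iz)$ is the zeroth spherical Hankel function of the first kind; $h_0(\omega(R+\sigma\,\cdot\,))$ denotes the function $\xi\mapsto h_0(\omega(R+\sigma\xi))$ on $[0,\infty)$. The square root $\sqrt z$ for $z\in\mathbb{C}\setminus\mathbb{R}_{\le 0}$ is the principal branch. *)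

theory Defs
  imports "HOL-Analysis.Analysis"
begin

text \<open>
  Elements of \<open>L\<^sub>2(\<real>\<^sub>\<ge>\<^sub>0)\<close> are represented by functions \<open>real \<Rightarrow> complex\<close>, whose values on the
  negative half-line are irrelevant.
\<close>

definition L2_halfline :: "(real \<Rightarrow> complex) set" where
  "L2_halfline = {f. set_borel_measurable lebesgue {0..} f \<and>
                     set_integrable lebesgue {0..} (\<lambda>x. (cmod (f x))\<^sup>2)}"

text \<open>
  The value is meaningful only on \<^const>\<open>L2_halfline\<close>, since a non-integrable function has
  Bochner integral 0; see \<open>hankel_error_in_L2\<close> below for the functions that matter.
\<close>

definition L2_norm_halfline :: "(real \<Rightarrow> complex) \<Rightarrow> real" where
  "L2_norm_halfline f = sqrt (LINT x:{0..}|lebesgue. (cmod (f x))\<^sup>2)"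

definition laguerre_poly :: "nat \<Rightarrow> real \<Rightarrow> real" where
  "laguerre_poly n x = (\<Sum>k\<le>n. real (n choose k) * (- x) ^ k / fact k)"

definition laguerre_fun :: "nat \<Rightarrow> real \<Rightarrow> real" where
  "laguerre_fun n x = exp (- x) * laguerre_poly n (2 * x)"

text \<open>The complex linear span of the Laguerre functions of index \<open>0, \<dots>, N\<close>.\<close>

definition laguerre_space :: "nat \<Rightarrow> (real \<Rightarrow> complex) set" where
  "laguerre_space N =
     {u. \<exists>c :: nat \<Rightarrow> complex. u = (\<lambda>x. \<Sum>n\<le>N. c n * complex_of_real (laguerre_fun n x))}"

definition spherical_hankel0 :: "complex \<Rightarrow> complex" where
  "spherical_hankel0 z = - (\<i> / z) * exp (\<i> * z)"

lemma L2_halflineI: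
  fixes f :: "real \<Rightarrow> complex"
  assumes cont: "continuous_on {0..} f"
    and bd: "\<And>x. x \<ge> 0 \<Longrightarrow> cmod (f x) \<le> C * exp (- a * x)" and a: "a > 0"
  shows "f \<in> L2_halfline"
proof -
  have c2: "continuous_on {0..} (\<lambda>x. (cmod (f x))\<^sup>2)"
    by (intro continuous_intros cont)
  have "(\<lambda>x. C\<^sup>2 * exp (- (2*a) * x)) integrable_on {0..}"
    using integrable_cmul[OF integrable_on_exp_minus_to_infinity[of "2*a" 0], of "C\<^sup>2"] a by simp
  moreover have "norm ((cmod (f x))\<^sup>2) \<le> C\<^sup>2 * exp (- (2*a) * x)" if "x \<in> {0..}" for x
  proof -
    have "(cmod (f x))\<^sup>2 \<le> (C * exp (- a * x))\<^sup>2"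
      using bd[of x] that by (intro power_mono) auto
    also have "\<dots> = C\<^sup>2 * exp (- (2*a) * x)"
      by (simp add: power_mult_distrib flip: exp_double)
    finally show ?thesis by simp
  qed
  moreover have "(\<lambda>x. (cmod (f x))\<^sup>2) \<in> borel_measurable (lebesgue_on {0..})"
    by (rule continuous_imp_measurable_on_sets_lebesgue[OF c2]) auto
  ultimately have "set_integrable lebesgue {0..} (\<lambda>x. (cmod (f x))\<^sup>2)"
    by (intro measurable_bounded_by_integrable_imp_absolutely_integrable) auto
  moreover have "f \<in> borel_measurable (lebesgue_on {0..})"
    by (rule continuous_imp_measurable_on_sets_lebesgue[OF cont]) auto
  then have "set_borel_measurable lebesgue {0..} f"
    unfolding set_borel_measurable_def
    by (subst borel_measurable_restrict_space_iff[symmetric]) auto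
  ultimately show ?thesis by (simp add: L2_halfline_def)
qed

lemma laguerre_fun_bound:
  assumes "x \<ge> 0"
  shows "\<bar>laguerre_fun n x\<bar> \<le> (\<Sum>k\<le>n. real (n choose k) * 4 ^ k) * exp (- (1/2) * x)"
proof -
  have "\<bar>laguerre_poly n (2*x)\<bar> \<le> (\<Sum>k\<le>n. \<bar>real (n choose k) * (- (2*x)) ^ k / fact k\<bar>)"
    unfolding laguerre_poly_def by (rule sum_abs)
  also have "\<dots> \<le> (\<Sum>k\<le>n. real (n choose k) * 4 ^ k * exp (x/2))"
  proof (rule sum_mono)
    fix k
    have e: "(x/2) ^ k / fact k \<le> exp (x/2)"
    proof -
      have "(\<Sum>j\<in>{k}. (x/2)^j /\<^sub>R fact j) \<le> (\<Sum>j. (x/2)^j /\<^sub>R fact j)"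
        by (rule sum_le_suminf) (use assms summable_exp_generic[of "x/2"] in auto)
      then show ?thesis by (simp add: exp_def field_simps)
    qed
    have "\<bar>real (n choose k) * (- (2*x)) ^ k / fact k\<bar>
            = real (n choose k) * 4 ^ k * ((x/2) ^ k / fact k)"
    proof -
      have "4 ^ k * (x/2) ^ k = (2*x) ^ k"
        by (simp only: power_mult_distrib[symmetric]) simp
      moreover have "\<bar>(- (2*x)) ^ k\<bar> = (2*x) ^ k"
        using assms by (simp only: power_abs) simp
      ultimately show ?thesis by (simp add: abs_mult mult.assoc)
    qed
    also have "\<dots> \<le> real (n choose k) * 4 ^ k * exp (x/2)"
      by (intro mult_left_mono e) auto
    finally show "\<bar>real (n choose k) * (- (2*x)) ^ k / fact k\<bar>
                    \<le> real (n choose k) * 4 ^ k * exp (x/2)" .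
  qed
  finally have *: "\<bar>laguerre_poly n (2*x)\<bar> \<le> (\<Sum>k\<le>n. real (n choose k) * 4 ^ k) * exp (x/2)"
    by (simp add: sum_distrib_right)
  have "\<bar>laguerre_fun n x\<bar> = exp (-x) * \<bar>laguerre_poly n (2*x)\<bar>"
    by (simp add: laguerre_fun_def abs_mult)
  also have "\<dots> \<le> exp (-x) * ((\<Sum>k\<le>n. real (n choose k) * 4 ^ k) * exp (x/2))"
    by (intro mult_left_mono *) auto
  also have "\<dots> = (\<Sum>k\<le>n. real (n choose k) * 4 ^ k) * (exp (-x) * exp (x/2))"
    by simp
  also have "exp (-x) * exp (x/2) = exp (- (1/2) * x)"
    by (simp flip: exp_add)
  finally show ?thesis .
qed

lemma hankel_error_in_L2:
  fixes R :: real and \<omega> \<sigma> :: complex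
  assumes R: "R > 0" and s: "Im \<sigma> > 0" and so: "Im (\<sigma> * \<omega>) > 0"
    and u: "u \<in> laguerre_space N"
  shows "(\<lambda>\<xi>. spherical_hankel0 (\<omega> * (complex_of_real R + \<sigma> * complex_of_real \<xi>)) - u \<xi>)
           \<in> L2_halfline"
proof -
  define z where "z = (\<lambda>\<xi>::real. \<omega> * (complex_of_real R + \<sigma> * complex_of_real \<xi>))"
  obtain c where c: "u = (\<lambda>x. \<Sum>n\<le>N. c n * complex_of_real (laguerre_fun n x))"
    using u by (auto simp: laguerre_space_def)
  have w: "\<omega> \<noteq> 0" using so by auto
  have nz: "complex_of_real R + \<sigma> * complex_of_real \<xi> \<noteq> 0" if "\<xi> \<ge> 0" for \<xi>
  proof
    assume "complex_of_real R + \<sigma> * complex_of_real \<xi> = 0"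
    then have "Im \<sigma> * \<xi> = 0" "R + Re \<sigma> * \<xi> = 0"
      by (auto simp: complex_eq_iff)
    then show False using R s by auto
  qed
  have contz: "continuous_on A z" for A
    unfolding z_def by (intro continuous_intros)
  have contu: "continuous_on A u" for A
    unfolding c laguerre_fun_def laguerre_poly_def by (intro continuous_intros) auto
  have z0: "z \<xi> \<noteq> 0" if "\<xi> \<ge> 0" for \<xi>
    using nz[OF that] w by (simp add: z_def)
  have conth: "continuous_on {0..} (\<lambda>\<xi>. spherical_hankel0 (z \<xi>))"
    unfolding spherical_hankel0_def by (intro continuous_intros contz) (use z0 in auto)
  text \<open>\<open>\<bar>R + \<sigma>\<xi>\<bar>\<close> is bounded below on the half-line, by its distance from 0 along the ray.\<close>
  define m where "m = Im \<sigma> * R / cmod \<sigma>"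
  have s0: "cmod \<sigma> > 0" using s by auto
  have m: "m > 0" using R s s0 by (auto simp: m_def)
  have low: "cmod (complex_of_real R + \<sigma> * complex_of_real \<xi>) \<ge> m" for \<xi>
  proof -
    have "Im \<sigma> * R = \<bar>Im (cnj \<sigma> * (complex_of_real R + \<sigma> * complex_of_real \<xi>))\<bar>"
      using R s by (simp add: algebra_simps)
    also have "\<dots> \<le> cmod (cnj \<sigma> * (complex_of_real R + \<sigma> * complex_of_real \<xi>))"
      by (rule abs_Im_le_cmod)
    also have "\<dots> = cmod \<sigma> * cmod (complex_of_real R + \<sigma> * complex_of_real \<xi>)"
      by (simp only: norm_mult complex_mod_cnj)
    finally show ?thesis using s0 by (simp add: m_def pos_divide_le_eq mult.commute)
  qed
  define b where "b = Im (\<sigma> * \<omega>)"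
  define C1 where "C1 = exp (- Im \<omega> * R) / (cmod \<omega> * m)"
  have C1: "C1 \<ge> 0" using m by (simp add: C1_def)
  have hb: "cmod (spherical_hankel0 (z \<xi>)) \<le> C1 * exp (- b * \<xi>)" for \<xi>
  proof -
    have Im: "Im (z \<xi>) = Im \<omega> * R + b * \<xi>"
      by (simp add: z_def b_def algebra_simps)
    have "cmod (spherical_hankel0 (z \<xi>)) = exp (- Im (z \<xi>)) / cmod (z \<xi>)"
      by (simp add: spherical_hankel0_def norm_mult norm_divide)
    also have "\<dots> \<le> exp (- Im (z \<xi>)) / (cmod \<omega> * m)"
    proof -
      have "cmod \<omega> * m \<le> cmod (z \<xi>)"
        unfolding z_def norm_mult using low[of \<xi>] by (intro mult_left_mono) auto
      moreover have "cmod \<omega> * m > 0" using w m by simp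
      ultimately show ?thesis by (intro frac_le) auto
    qed
    also have "\<dots> = C1 * exp (- b * \<xi>)"
      by (simp add: Im C1_def exp_add[symmetric] algebra_simps)
    finally show ?thesis .
  qed
  define K where "K = (\<lambda>n. \<Sum>k\<le>n. real (n choose k) * 4 ^ k)"
  define C2 where "C2 = (\<Sum>n\<le>N. cmod (c n) * K n)"
  have C2: "C2 \<ge> 0" by (auto simp: C2_def K_def intro!: sum_nonneg mult_nonneg_nonneg)
  have ub: "cmod (u \<xi>) \<le> C2 * exp (- (1/2) * \<xi>)" if "\<xi> \<ge> 0" for \<xi>
  proof -
    have "cmod (u \<xi>) \<le> (\<Sum>n\<le>N. cmod (c n * complex_of_real (laguerre_fun n \<xi>)))"
      unfolding c by (rule norm_sum)
    also have "\<dots> \<le> (\<Sum>n\<le>N. cmod (c n) * (K n * exp (- (1/2) * \<xi>)))"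
      unfolding norm_mult norm_of_real K_def
      by (intro sum_mono mult_left_mono laguerre_fun_bound that) auto
    finally show ?thesis by (simp only: C2_def sum_distrib_right mult.assoc)
  qed
  define a where "a = min b (1/2)"
  have a: "a > 0" "a \<le> b" "a \<le> 1/2" using so unfolding a_def b_def[symmetric] by linarith+
  have "cmod (spherical_hankel0 (z \<xi>) - u \<xi>) \<le> (C1 + C2) * exp (- a * \<xi>)" if "\<xi> \<ge> 0" for \<xi>
  proof -
    have "cmod (spherical_hankel0 (z \<xi>) - u \<xi>) \<le> C1 * exp (- b * \<xi>) + C2 * exp (- (1/2) * \<xi>)"
      using norm_triangle_ineq4[of "spherical_hankel0 (z \<xi>)" "u \<xi>"] hb[of \<xi>] ub[OF that] by linarith
    also have "\<dots> \<le> C1 * exp (- a * \<xi>) + C2 * exp (- a * \<xi>)"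
      using mult_right_mono[OF a(2) that] mult_right_mono[OF a(3) that] C1 C2
      by (intro add_mono mult_left_mono) auto
    finally show ?thesis by (simp add: algebra_simps)
  qed
  then have "(\<lambda>\<xi>. spherical_hankel0 (z \<xi>) - u \<xi>) \<in> L2_halfline"
    using a(1) by (intro L2_halflineI continuous_intros conth contu)
  then show ?thesis by (simp add: z_def)
qed

end

theory Submission
  imports Defs "HOL-Probability.Distributions" "HOL-Real_Asymp.Real_Asymp"
begin

text \<open>
  With \<open>p = - \<i>\<sigma>\<omega>\<close> and \<open>\<rho> = R / \<sigma>\<close> the function to be approximated is a multiple of
  \<open>exp (- p x) / (x + \<rho>)\<close>, that is, a superposition of exponentials \<open>exp (- s x)\<close> with \<open>s\<close> on the
  ray from \<open>p\<close> in the direction \<open>1 / sqrt \<rho>\<close>. By orthogonality, the truncated Laguerre expansion of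
  \<open>exp (- s x)\<close> has the squared error \<open>\<bar>(s - 1) / (s + 1)\<bar> ^ (2 (N + 1)) / (2 Re s)\<close>, and Minkowski's
  integral inequality integrates these errors along the ray. The chosen ray is one of steepest
  descent: it is asymptotic to a ray through the saddle point \<open>sqrt (2 (N + 1) / \<rho>)\<close> of
  \<open>s \<rho> + 2 (N + 1) / s\<close>, and in the parameter \<open>y\<close> with \<open>s = p + (y\<^sup>2 - \<beta>) / sqrt \<rho>\<close> the integrand is
  dominated by a Gaussian whose width does not depend on \<open>N\<close>, so that no power of \<open>N\<close> is lost. The
  endpoint contribution of order \<open>\<bar>(1 - p) / (1 + p)\<bar> ^ (N + 1)\<close> decays exponentially in \<open>N\<close> and is
  absorbed by the second term of the bound.
\<close>

section \<open>Integration over a half-line\<close>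

text \<open>Borel sets, because the exchange of integrals rests on joint measurability on the
  product with \<open>lborel\<close>. The passage from \<open>lebesgue\<close> takes place once, in
  \<open>laguerre_approx_of_exp_superposition\<close>.\<close>

abbreviation "halfline \<equiv> restrict_space lborel {0::real..}"

text \<open>Integrability comes from the majorant \<open>C * g\<close>: the antiderivative
  \<open>G\<close> of \<open>g\<close> has a finite limit, so \<open>g\<close> has a finite
  integral. The fundamental theorem for interval integrals then gives the value.\<close>

lemma has_bochner_integral_FTC_Ici:
  fixes f F :: "real \<Rightarrow> complex" and g G :: "real \<Rightarrow> real"
  assumes F: "\<And>x. (F has_vector_derivative f x) (at x)"
    and f: "continuous_on UNIV f"
    and F_lim: "(F \<longlongrightarrow> 0) at_top"
    and f_le: "\<And>x. x \<ge> a \<Longrightarrow> cmod (f x) \<le> C * g x"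
    and g: "continuous_on UNIV g" "\<And>x. x \<ge> a \<Longrightarrow> 0 \<le> g x"
    and G: "\<And>x. x \<ge> a \<Longrightarrow> (G has_real_derivative g x) (at x)"
    and G_lim: "(G \<longlongrightarrow> T) at_top"
  shows "has_bochner_integral lborel (\<lambda>x. indicator {a..} x *\<^sub>R f x) (- F a)"
proof -
  have fm [measurable]: "f \<in> borel_measurable borel" and gm [measurable]: "g \<in> borel_measurable borel"
    using f g(1) by (simp_all add: borel_measurable_continuous_onI)
  have "(\<integral>\<^sup>+x. ennreal (g x) * indicator {a..} x \<partial>lborel) = ennreal (T - G a)"
    by (rule nn_integral_FTC_atLeast) (use g G G_lim in auto)
  moreover have "(\<integral>\<^sup>+x. ennreal (g x) * indicator {a..} x \<partial>lborel)
      = (\<integral>\<^sup>+x. ennreal (g x * indicator {a..} x) \<partial>lborel)"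
    by (intro nn_integral_cong) (auto simp: indicator_def)
  ultimately have "(\<integral>\<^sup>+x. ennreal (g x * indicator {a..} x) \<partial>lborel) < \<infinity>"
    by (simp only: ennreal_less_top infinity_ennreal_def)
  then have "integrable lborel (\<lambda>x. g x * indicator {a..} x)"
    by (intro integrableI_nonneg AE_I2) (use g in \<open>auto simp: indicator_def\<close>)
  then have "integrable lborel (\<lambda>x. C * (g x * indicator {a..} x))"
    by simp
  then have int: "integrable lborel (\<lambda>x. indicator {a..} x *\<^sub>R f x)"
    by (rule Bochner_Integration.integrable_bound) (use f_le in \<open>auto simp: indicator_def intro!: AE_I2 order_trans[OF f_le]\<close>)
  have "(LBINT x=ereal a..\<infinity>. f x) = 0 - F a"
  proof (rule interval_integral_FTC_integrable)
    show "isCont f x" for x using f by (simp add: continuous_on_eq_continuous_at)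
    have "set_integrable lborel {a..} f" using int by (simp add: set_integrable_def)
    then show "set_integrable lborel (einterval (ereal a) \<infinity>) f"
      by (rule set_integrable_subset) auto
    have "isCont F a" by (rule has_vector_derivative_continuous[OF F])
    then show "((F \<circ> real_of_ereal) \<longlongrightarrow> F a) (at_right (ereal a))"
      by (auto simp: ereal_tendsto_simps isCont_def intro: tendsto_within_subset filterlim_mono at_le)
    show "((F \<circ> real_of_ereal) \<longlongrightarrow> 0) (at_left \<infinity>)"
      using F_lim by (simp add: ereal_tendsto_simps)
  qed (use F in auto)
  also have "(LBINT x=ereal a..\<infinity>. f x) = (LBINT x:{a<..}. f x)"
    by (rule interval_integral_to_infinity_eq)
  also have "\<dots> = (LBINT x:{a..}. f x)"
    unfolding set_lebesgue_integral_def
    by (intro integral_cong_AE) (use AE_lborel_singleton[of a] in \<open>auto simp: indicator_def elim!: eventually_mono\<close>)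
  finally show ?thesis
    using int by (simp add: has_bochner_integral_iff set_lebesgue_integral_def)
qed

section \<open>Laplace transforms and orthogonality of the Laguerre functions\<close>

text \<open>Vandermonde's convolution, because \<open>(-1) ^ j * ((j + k) choose k)\<close> is
  \<open>(- k - 1) gchoose j\<close>. For \<open>k < n\<close> the upper index on the right is a
  natural number below \<open>n\<close>, so the sum vanishes; this is the source of
  orthogonality.\<close>

lemma gbinomial_alternating_sum:
  "(\<Sum>j\<le>n. real (n choose j) * (-1) ^ j * real ((j + k) choose k)) = (real n - real k - 1) gchoose n"
proof -
  have "(\<Sum>j\<le>n. real (n choose j) * (-1) ^ j * real ((j + k) choose k))
     = (\<Sum>j=0..n. ((- real k - 1) gchoose j) * (real n gchoose (n - j)))"
  proof (rule sum.cong)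
    fix j assume "j \<in> {0..n}"
    then have "real n gchoose (n - j) = real (n choose j)"
      using binomial_symmetric[of j n] by (simp flip: binomial_gbinomial)
    moreover have "(- real k - 1) gchoose j = (-1)^j * real ((j + k) choose k)"
      using binomial_symmetric[of k "j+k"] gbinomial_minus[of "real k + 1" j]
      by (simp add: binomial_gbinomial add.commute[of "real j"])
    ultimately show "real (n choose j) * (-1) ^ j * real ((j + k) choose k) = ((- real k - 1) gchoose j) * (real n gchoose (n - j))" by simp
  qed auto
  also have "\<dots> = (- real k - 1 + real n) gchoose n" by (rule gbinomial_Vandermonde)
  finally show ?thesis by (simp add: algebra_simps)
qed


text \<open>\<open>(b * x) ^ k / fact k\<close> is a single term of the series of
  \<open>exp (b * x)\<close>, so half of the decay rate pays for the power.\<close>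

lemma power_mult_exp_minus_le:
  fixes x b :: real
  assumes "x \<ge> 0" "b > 0"
  shows "x ^ k * exp (- (2 * b) * x) \<le> fact k / b ^ k * exp (- b * x)"
proof -
  have "(\<Sum>j\<in>{k}. (b*x)^j /\<^sub>R fact j) \<le> (\<Sum>j. (b*x)^j /\<^sub>R fact j)"
    by (rule sum_le_suminf) (use assms summable_exp_generic[of "b*x"] in auto)
  then have "b ^ k * x ^ k \<le> fact k * exp (b * x)"
    by (simp add: exp_def field_simps)
  then have "x ^ k \<le> fact k / b ^ k * exp (b * x)"
    using assms by (simp add: field_simps)
  then have "x ^ k * exp (- (2 * b) * x) \<le> fact k / b ^ k * exp (b * x) * exp (- (2 * b) * x)"
    by (intro mult_right_mono) auto
  also have "\<dots> = fact k / b ^ k * exp (- b * x)"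
    by (simp add: mult.assoc flip: exp_add)
  finally show ?thesis .
qed

text \<open>Integration by parts and induction on \<open>k\<close>. Multiples of
  \<open>exp (- b * x)\<close>, with \<open>b\<close> half of \<open>Re a\<close>, are the majorants
  at every stage.\<close>

lemma has_bochner_integral_power_exp:
  fixes a :: complex
  assumes a: "Re a > 0"
  shows "has_bochner_integral halfline (\<lambda>x. of_real x ^ k * exp (- a * of_real x)) (fact k / a ^ Suc k)"
proof -
  define b where "b = Re a / 2"
  have b: "b > 0" using a by (simp add: b_def)
  have a0: "a \<noteq> 0" using a by auto
  define e where "e = (\<lambda>k x. complex_of_real x ^ k * exp (- a * of_real x))"
  have norm_e: "cmod (e k x) \<le> fact k / b ^ k * exp (- b * x)" if "x \<ge> 0" for x k
    using power_mult_exp_minus_le[OF that b, of k] that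
    by (simp add: e_def norm_mult norm_power b_def)
  have G: "((\<lambda>x. - exp (- b * x) / b) has_real_derivative exp (- b * x)) (at x)" for x
    using b by (auto intro!: derivative_eq_intros)
  have exp_lim: "((\<lambda>x. exp (- b * x)) \<longlongrightarrow> 0) at_top"
    using b by real_asymp
  have G_lim: "((\<lambda>x. - exp (- b * x) / b) \<longlongrightarrow> 0) at_top"
    using tendsto_divide[OF tendsto_minus[OF exp_lim] tendsto_const[of b]] b by simp
  have e_lim: "(e k \<longlongrightarrow> 0) at_top" for k
  proof (rule Lim_null_comparison)
    show "((\<lambda>x. fact k / b ^ k * exp (- b * x)) \<longlongrightarrow> 0) at_top"
      by (rule tendsto_mult_right_zero[OF exp_lim])
    show "\<forall>\<^sub>F x in at_top. norm (e k x) \<le> fact k / b ^ k * exp (- b * x)"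
      using eventually_ge_at_top[of 0] by eventually_elim (rule norm_e)
  qed
  have cont_e: "continuous_on UNIV (e k)" for k
    unfolding e_def by (intro continuous_intros)
  have "has_bochner_integral halfline (e k) (fact k / a ^ Suc k)"
  proof (induction k)
    case 0
    have "has_bochner_integral lborel (\<lambda>x. indicator {0..} x *\<^sub>R e 0 x) (- (- e 0 0 / a))"
    proof (rule has_bochner_integral_FTC_Ici[OF _ cont_e _ norm_e _ _ G G_lim])
      show "((\<lambda>x. - e 0 x / a) has_vector_derivative e 0 x) (at x)" for x
        unfolding e_def using a0 by (auto intro!: derivative_eq_intros has_vector_derivative_real_field)
      show "((\<lambda>x. - e 0 x / a) \<longlongrightarrow> 0) at_top"
        using tendsto_divide[OF tendsto_minus[OF e_lim] tendsto_const[of a]] a0 by simp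
    qed (auto intro!: continuous_intros)
    then show ?case
      by (simp add: has_bochner_integral_restrict_space) (simp add: e_def)
  next
    case (Suc k)
    let ?C = "fact (Suc k) / b ^ Suc k + cmod (of_nat (Suc k) / a) * (fact k / b ^ k)"
    \<comment> \<open>The integrand is the derivative of \<open>- e (Suc k) x / a\<close>, which
      vanishes at 0 and at infinity; that its integral is 0 is the recursion in
      \<open>k\<close>.\<close>
    have "has_bochner_integral lborel (\<lambda>x. indicator {0..} x *\<^sub>R (e (Suc k) x - of_nat (Suc k) / a * e k x)) (- (- e (Suc k) 0 / a))"
    proof (rule has_bochner_integral_FTC_Ici[where C = ?C, OF _ _ _ _ _ _ G G_lim])
      show "((\<lambda>x. - e (Suc k) x / a) has_vector_derivative e (Suc k) x - of_nat (Suc k) / a * e k x) (at x)" for x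
        unfolding e_def using a0
        by (auto intro!: derivative_eq_intros has_vector_derivative_real_field)
           (cases k; simp add: field_simps)
      show "((\<lambda>x. - e (Suc k) x / a) \<longlongrightarrow> 0) at_top"
        using tendsto_divide[OF tendsto_minus[OF e_lim] tendsto_const[of a]] a0 by simp
      fix x :: real assume x: "0 \<le> x"
      have "cmod (e (Suc k) x - of_nat (Suc k) / a * e k x) \<le> cmod (e (Suc k) x) + cmod (of_nat (Suc k) / a) * cmod (e k x)"
        using norm_triangle_ineq4 norm_mult by metis
      also have "\<dots> \<le> fact (Suc k) / b ^ Suc k * exp (- b * x) + cmod (of_nat (Suc k) / a) * (fact k / b ^ k * exp (- b * x))"
        by (intro add_mono mult_left_mono norm_e x) auto
      finally show "cmod (e (Suc k) x - of_nat (Suc k) / a * e k x) \<le> ?C * exp (- b * x)"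
        by (simp only: distrib_right mult.assoc)
    qed (use a0 in \<open>auto intro!: continuous_intros cont_e\<close>)
    then have "has_bochner_integral halfline (\<lambda>x. e (Suc k) x - of_nat (Suc k) / a * e k x) 0"
      by (simp add: has_bochner_integral_restrict_space) (simp add: e_def)
    from has_bochner_integral_add[OF this has_bochner_integral_mult_right[OF Suc, of "of_nat (Suc k) / a"]]
    show ?case using a0 by (simp add: field_simps)
  qed
  then show ?thesis by (simp only: e_def)
qed


lemma laguerre_fun_eq_sum:
  "complex_of_real (laguerre_fun n x)
     = (\<Sum>k\<le>n. of_nat (n choose k) * (-2) ^ k / fact k * (of_real x ^ k * exp (- of_real x)))"
proof -
  have "complex_of_real (laguerre_fun n x)
      = (\<Sum>k\<le>n. exp (- of_real x) * (of_nat (n choose k) * (-2 * of_real x) ^ k / fact k))"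
    by (simp add: laguerre_fun_def laguerre_poly_def sum_distrib_left exp_of_real[symmetric])
  also have "\<dots> = (\<Sum>k\<le>n. of_nat (n choose k) * (-2) ^ k / fact k * (of_real x ^ k * exp (- of_real x)))"
    by (intro sum.cong refl) (simp only: power_mult_distrib, simp)
  finally show ?thesis .
qed

text \<open>Termwise Laplace transforms at \<open>s + 1\<close> cancel the factorials, and the
  binomial theorem sums what remains to \<open>(1 - 2 / (s + 1)) ^ n / (s + 1)\<close>.\<close>

lemma has_bochner_integral_exp_laguerre_fun:
  assumes s: "Re s > -1"
  shows "has_bochner_integral halfline
           (\<lambda>x. exp (- s * of_real x) * of_real (laguerre_fun n x)) ((s - 1) ^ n / (s + 1) ^ Suc n)"
proof -
  have s0: "s + 1 \<noteq> 0" using s by (auto simp: complex_eq_iff)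
  define b where "b = (\<lambda>k. of_nat (n choose k) * (-2) ^ k / fact k :: complex)"
  have "has_bochner_integral halfline
      (\<lambda>x. \<Sum>k\<le>n. b k * (of_real x ^ k * exp (- (s + 1) * of_real x))) (\<Sum>k\<le>n. b k * (fact k / (s + 1) ^ Suc k))"
    using s by (intro has_bochner_integral_sum has_bochner_integral_mult_right has_bochner_integral_power_exp) simp
  moreover have "(\<Sum>k\<le>n. b k * (of_real x ^ k * exp (- (s + 1) * of_real x)))
      = exp (- s * of_real x) * of_real (laguerre_fun n x)" for x
    by (simp add: laguerre_fun_eq_sum b_def sum_distrib_left exp_add[symmetric] algebra_simps)
       (simp add: exp_diff exp_minus field_simps)
  moreover have "(\<Sum>k\<le>n. b k * (fact k / (s + 1) ^ Suc k)) = (s - 1) ^ n / (s + 1) ^ Suc n"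
  proof -
    have "(\<Sum>k\<le>n. b k * (fact k / (s + 1) ^ Suc k)) = (\<Sum>k\<le>n. of_nat (n choose k) * (-2 / (s + 1)) ^ k * 1 ^ (n - k)) / (s + 1)"
      unfolding sum_divide_distrib
      by (intro sum.cong refl) (simp only: b_def power_divide power_Suc, simp)
    also have "\<dots> = (-2 / (s + 1) + 1) ^ n / (s + 1)"
      by (simp only: binomial_ring)
    also have "-2 / (s + 1) + 1 = (s - 1) / (s + 1)"
      using s0 by (simp add: field_simps)
    finally show ?thesis by (simp add: power_divide)
  qed
  ultimately show ?thesis by simp
qed

text \<open>The two exponentials combine to rate 2, whose powers cancel those in the Laguerre
  coefficients up to \<open>2 ^ Suc k\<close>. As \<open>fact (j + k) / fact j\<close> is
  \<open>fact k\<close> times a binomial coefficient, \<open>gbinomial_alternating_sum\<close>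
  remains.\<close>

lemma has_bochner_integral_power_laguerre_fun:
  "has_bochner_integral halfline (\<lambda>x. of_real x ^ k * exp (- of_real x) * of_real (laguerre_fun n x))
     (complex_of_real (fact k / 2 ^ Suc k * ((real n - real k - 1) gchoose n)))"
proof -
  define b where "b = (\<lambda>k. of_nat (n choose k) * (-2) ^ k / fact k :: complex)"
  have "has_bochner_integral halfline
      (\<lambda>x. \<Sum>j\<le>n. b j * (of_real x ^ (j + k) * exp (- 2 * of_real x))) (\<Sum>j\<le>n. b j * (fact (j + k) / 2 ^ Suc (j + k)))"
    by (intro has_bochner_integral_sum has_bochner_integral_mult_right has_bochner_integral_power_exp) simp
  moreover have "(\<Sum>j\<le>n. b j * (of_real x ^ (j + k) * exp (- 2 * of_real x)))
      = of_real x ^ k * exp (- of_real x) * of_real (laguerre_fun n x)" for x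
  proof -
    have "exp (- 2 * of_real x) = exp (- of_real x) * exp (- complex_of_real x)"
      by (simp flip: exp_add)
    then show ?thesis
      by (simp add: laguerre_fun_eq_sum b_def sum_distrib_left power_add mult_ac)
  qed
  moreover have "(\<Sum>j\<le>n. b j * (fact (j + k) / 2 ^ Suc (j + k)))
      = of_real (fact k / 2 ^ Suc k * ((real n - real k - 1) gchoose n))"
  proof -
    have "b j * (fact (j + k) / 2 ^ Suc (j + k))
        = of_real (fact k / 2 ^ Suc k * (real (n choose j) * (-1) ^ j * real ((j + k) choose k)))" for j
    proof -
      have "(-2::complex) ^ j = (-1) ^ j * 2 ^ j"
        by (simp flip: power_mult_distrib)
      then show ?thesis
        by (simp add: b_def binomial_fact power_add)
    qed
    then show ?thesis
      by (simp only: of_real_sum[symmetric] sum_distrib_left[symmetric] gbinomial_alternating_sum)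
  qed
  ultimately show ?thesis by (simp only:)
qed

text \<open>Only the function of smaller index is expanded in powers. The terms of order below
  \<open>n\<close> integrate to 0 against \<open>laguerre_fun n\<close>, so at most the top term
  survives, and only for \<open>m = n\<close>.\<close>

lemma laguerre_fun_orthogonal_aux:
  assumes "m \<le> n"
  shows "has_bochner_integral halfline (\<lambda>x. of_real (laguerre_fun m x) * of_real (laguerre_fun n x))
           (if m = n then 1 / 2 else 0 :: complex)"
proof -
  define b where "b = (\<lambda>k. of_nat (m choose k) * (-2) ^ k / fact k :: complex)"
  define I where "I = (\<lambda>k. complex_of_real (fact k / 2 ^ Suc k * ((real n - real k - 1) gchoose n)))"
  have "has_bochner_integral halfline
      (\<lambda>x. \<Sum>k\<le>m. b k * (of_real x ^ k * exp (- of_real x) * of_real (laguerre_fun n x))) (\<Sum>k\<le>m. b k * I k)"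
    unfolding I_def
    by (intro has_bochner_integral_sum has_bochner_integral_mult_right has_bochner_integral_power_laguerre_fun)
  moreover have "(\<Sum>k\<le>m. b k * (of_real x ^ k * exp (- of_real x) * of_real (laguerre_fun n x)))
      = of_real (laguerre_fun m x) * of_real (laguerre_fun n x)" for x
    by (simp add: laguerre_fun_eq_sum[of m] b_def sum_distrib_right mult.assoc)
  moreover have "(\<Sum>k\<le>m. b k * I k) = (if m = n then 1 / 2 else 0)"
  proof -
    have "I k = 0" if "k < n" for k
    proof -
      have "real n - real k - 1 = real (n - k - 1)" using that by simp
      then have "(real n - real k - 1) gchoose n = real ((n - k - 1) choose n)"
        by (simp only: binomial_gbinomial)
      also have "\<dots> = 0" using that by simp
      finally show ?thesis by (simp add: I_def)
    qed
    \<comment> \<open>The signs of \<open>(-2) ^ n\<close> and \<open>(-1) gchoose n\<close> cancel,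
      as do the factorials and all powers of 2 but one; this gives the squared norm 1/2.\<close>
    moreover have "b n * I n = 1 / 2" if "m = n"
    proof -
      have "(- 1 :: real) gchoose n = (- 1) ^ n"
        using gbinomial_minus[of "1::real" n] by (simp flip: binomial_gbinomial)
      moreover have "(-2::complex) ^ n = (-1) ^ n * 2 ^ n"
        by (simp flip: power_mult_distrib)
      ultimately show ?thesis using that
        by (simp add: b_def I_def flip: power_mult_distrib)
    qed
    ultimately show ?thesis
      using assms by (cases "m = n") (auto simp: lessThan_Suc_atMost[symmetric])
  qed
  ultimately show ?thesis by simp
qed

lemma laguerre_fun_orthogonal:
  "has_bochner_integral halfline (\<lambda>x. of_real (laguerre_fun m x) * of_real (laguerre_fun n x))
     (if m = n then 1 / 2 else 0 :: complex)"
  using laguerre_fun_orthogonal_aux[of m n] laguerre_fun_orthogonal_aux[of n m]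
  by (cases "m \<le> n") (auto simp: mult.commute)

section \<open>Truncated Laguerre expansion of a decaying exponential\<close>

text \<open>The Fourier coefficient of \<open>exp (- s * x)\<close>: its integral against
  \<open>laguerre_fun n\<close>, divided by the squared norm 1/2.\<close>

definition laguerre_exp_coeff :: "complex \<Rightarrow> nat \<Rightarrow> complex" where
  "laguerre_exp_coeff s n = 2 / (s + 1) * ((s - 1) / (s + 1)) ^ n"

definition laguerre_exp_error :: "nat \<Rightarrow> complex \<Rightarrow> real \<Rightarrow> complex" where
  "laguerre_exp_error N s x =
     exp (- s * of_real x) - (\<Sum>n\<le>N. laguerre_exp_coeff s n * of_real (laguerre_fun n x))"

text \<open>Serves twice: it lets the geometric series of squared coefficients be summed exactly,
  and it yields the exponential bound \<open>cayley_power_le\<close>.\<close>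

lemma cmod_cayley_square:
  assumes "Re s > 0"
  shows "(cmod ((s - 1) / (s + 1)))\<^sup>2 = 1 - 4 * Re s / (cmod (s + 1))\<^sup>2"
proof -
  have "s + 1 \<noteq> 0" using assms by (auto simp: complex_eq_iff)
  moreover have "(cmod (s - 1))\<^sup>2 = (cmod (s + 1))\<^sup>2 - 4 * Re s"
    unfolding cmod_power2 by (simp add: power2_eq_square algebra_simps)
  ultimately show ?thesis
    by (simp add: norm_divide power_divide field_simps)
qed

text \<open>Pythagoras: the squared error is the squared norm \<open>1 / (2 * Re s)\<close> minus
  the energy \<open>A\<close> of the first \<open>N + 1\<close> coefficients, a finite geometric
  series with ratio \<open>t\<close>.\<close>

lemma has_bochner_integral_laguerre_exp_error:
  assumes s: "Re s > 0"
  shows "has_bochner_integral halfline (\<lambda>x. (cmod (laguerre_exp_error N s x))\<^sup>2)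
           (cmod ((s - 1) / (s + 1)) ^ (2 * (N + 1)) / (2 * Re s))"
proof -
  define c where "c = laguerre_exp_coeff s"
  define t where "t = (cmod ((s - 1) / (s + 1)))\<^sup>2"
  define A where "A = (\<Sum>n\<le>N. (cmod (c n))\<^sup>2 / 2)"
  let ?e = "\<lambda>s x. exp (- s * of_real x)" and ?l = "\<lambda>n x. complex_of_real (laguerre_fun n x)"
  have s1: "s + 1 \<noteq> 0" using s by (auto simp: complex_eq_iff)
  have coeff: "(s - 1) ^ n / (s + 1) ^ Suc n = c n / 2" for n
    by (simp add: c_def laguerre_exp_coeff_def power_divide)
  have A_eq: "complex_of_real A = (\<Sum>n\<le>N. cnj (c n) * (c n / 2))"
    unfolding A_def of_real_sum
    by (intro sum.cong refl) (simp only: of_real_divide complex_norm_square, simp)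
  have "has_bochner_integral halfline (\<lambda>x. of_real x ^ 0 * exp (- (s + cnj s) * of_real x)) (fact 0 / (s + cnj s) ^ Suc 0)"
    using s by (intro has_bochner_integral_power_exp) simp
  moreover have "cnj (?e s x) * ?e s x = exp (- (s + cnj s) * of_real x)" for x
  proof -
    have "cnj (?e s x) = exp (- cnj s * of_real x)" by (simp add: exp_cnj)
    then show ?thesis by (simp add: algebra_simps flip: exp_add)
  qed
  ultimately have ee: "has_bochner_integral halfline (\<lambda>x. cnj (?e s x) * ?e s x) (of_real (1 / (2 * Re s)))"
    by (simp add: complex_add_cnj)
  have es': "has_bochner_integral halfline (\<lambda>x. \<Sum>n\<le>N. cnj (c n) * (?e s x * ?l n x)) (of_real A)"
    unfolding A_eq coeff[symmetric] using s
    by (intro has_bochner_integral_sum has_bochner_integral_mult_right has_bochner_integral_exp_laguerre_fun) simp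
  have se': "has_bochner_integral halfline (\<lambda>x. cnj (\<Sum>n\<le>N. cnj (c n) * (?e s x * ?l n x))) (of_real A)"
    using has_bochner_integral_bounded_linear[OF bounded_linear_cnj es'] by simp
  have "has_bochner_integral halfline (\<lambda>x. \<Sum>n\<le>N. \<Sum>m\<le>N. cnj (c n) * c m * (?l n x * ?l m x))
      (\<Sum>n\<le>N. \<Sum>m\<le>N. cnj (c n) * c m * (if n = m then 1 / 2 else 0))"
    by (intro has_bochner_integral_sum has_bochner_integral_mult_right laguerre_fun_orthogonal)
  moreover have "(\<Sum>n\<le>N. \<Sum>m\<le>N. cnj (c n) * c m * (if n = m then 1 / 2 else 0)) = of_real A"
    by (simp add: A_eq if_distrib[of "\<lambda>x. _ * x"] cong: if_cong)
  ultimately have ss: "has_bochner_integral halfline (\<lambda>x. \<Sum>n\<le>N. \<Sum>m\<le>N. cnj (c n) * c m * (?l n x * ?l m x)) (of_real A)"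
    by simp
  \<comment> \<open>Each of the three sums integrates to \<open>A\<close>, so with their signs
    \<open>1 / (2 * Re s) - A\<close> is left.\<close>
  have expand: "cnj (laguerre_exp_error N s x) * laguerre_exp_error N s x
     = cnj (?e s x) * ?e s x - (\<Sum>n\<le>N. cnj (c n) * (?e s x * ?l n x))
       - cnj (\<Sum>n\<le>N. cnj (c n) * (?e s x * ?l n x)) + (\<Sum>n\<le>N. \<Sum>m\<le>N. cnj (c n) * c m * (?l n x * ?l m x))" for x
  proof -
    define S where "S = (\<Sum>n\<le>N. c n * ?l n x)"
    have "laguerre_exp_error N s x = ?e s x - S"
      by (simp add: laguerre_exp_error_def c_def S_def)
    moreover have "(\<Sum>n\<le>N. \<Sum>m\<le>N. cnj (c n) * c m * (?l n x * ?l m x)) = cnj S * S"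
      unfolding S_def by (simp only: cnj_sum sum_product) (simp add: mult_ac)
    moreover have "(\<Sum>n\<le>N. cnj (c n) * (?e s x * ?l n x)) = ?e s x * cnj S"
      by (simp add: S_def sum_distrib_left mult_ac)
    ultimately show ?thesis
      by (simp only:) (simp add: algebra_simps)
  qed
  have "has_bochner_integral halfline (\<lambda>x. cnj (laguerre_exp_error N s x) * laguerre_exp_error N s x)
      (of_real (1 / (2 * Re s)) - of_real A - of_real A + of_real A)"
    unfolding expand
    by (intro has_bochner_integral_add has_bochner_integral_diff ee es' se' ss)
  from has_bochner_integral_bounded_linear[OF bounded_linear_Re this]
  have "has_bochner_integral halfline (\<lambda>x. (cmod (laguerre_exp_error N s x))\<^sup>2) (1 / (2 * Re s) - A)"
    unfolding cmod_power2 by (simp add: power2_eq_square)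
  \<comment> \<open>In \<open>2 * Re s * A\<close> the factor before the geometric sum is exactly
    \<open>1 - t\<close>, so the sum telescopes.\<close>
  moreover have "1 / (2 * Re s) - A = t ^ (N + 1) / (2 * Re s)"
  proof -
    have one_t: "1 - t = 4 * Re s / (cmod (s + 1))\<^sup>2"
      using cmod_cayley_square[OF s] by (simp add: t_def)
    have "A = 2 / (cmod (s + 1))\<^sup>2 * (\<Sum>n\<le>N. t ^ n)"
      unfolding A_def sum_distrib_left
      by (intro sum.cong refl)
         (simp add: c_def laguerre_exp_coeff_def t_def norm_mult norm_divide norm_power power_mult_distrib power_divide mult.commute flip: power_mult)
    then have "2 * Re s * A = (1 - t) * (\<Sum>n\<le>N. t ^ n)"
      by (simp add: one_t)
    also have "\<dots> = 1 - t ^ (N + 1)"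
      using one_diff_power_eq[of t "Suc N"] by (simp add: lessThan_Suc_atMost)
    finally show ?thesis using s by (simp add: field_simps)
  qed
  ultimately show ?thesis by (simp only: t_def power_mult)
qed

section \<open>Minkowski's integral inequality with a majorant\<close>

text \<open>Cauchy-Schwarz for the product of \<open>norm (F x y) / sqrt (w x)\<close> and
  \<open>sqrt (w x)\<close> gives one factor \<open>W\<close> for every \<open>y\<close>. By
  Tonelli, integrating the other factor over \<open>y\<close> turns
  \<open>(w x)\<^sup>2 / w x\<close> into \<open>w x\<close> and gives the second. The majorant
  \<open>w\<close> lets an explicit bound stand for the norms of the slices.\<close>

lemma minkowski_integral_inequality:
  fixes F :: "'a \<Rightarrow> 'b \<Rightarrow> 'c::{banach, second_countable_topology}"
  assumes "sigma_finite_measure M1" "sigma_finite_measure M2"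
    and F [measurable]: "(\<lambda>(x, y). F x y) \<in> borel_measurable (M1 \<Otimes>\<^sub>M M2)"
    and w [measurable]: "w \<in> borel_measurable M1" and w_pos: "\<And>x. x \<in> space M1 \<Longrightarrow> 0 < w x"
    and F_le: "\<And>x. x \<in> space M1 \<Longrightarrow> (\<integral>\<^sup>+y. ennreal ((norm (F x y))\<^sup>2) \<partial>M2) \<le> ennreal ((w x)\<^sup>2)"
  shows "(\<integral>\<^sup>+y. ennreal ((norm (\<integral>x. F x y \<partial>M1))\<^sup>2) \<partial>M2) \<le> (\<integral>\<^sup>+x. ennreal (w x) \<partial>M1)\<^sup>2"
proof -
  interpret pair_sigma_finite M1 M2 by (simp add: pair_sigma_finite_def assms)
  define W where "W = (\<integral>\<^sup>+x. ennreal (w x) \<partial>M1)"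
  have pointwise: "ennreal ((norm (\<integral>x. F x y \<partial>M1))\<^sup>2) \<le> (\<integral>\<^sup>+x. ennreal ((norm (F x y))\<^sup>2 / w x) \<partial>M1) * W"
    if y [measurable]: "y \<in> space M2" for y
  proof -
    have [measurable]: "(\<lambda>x. F x y) \<in> borel_measurable M1"
      using measurable_compose[OF measurable_Pair2'[OF y] F] by simp
    \<comment> \<open>If \<open>F x y\<close> is not integrable in \<open>x\<close>, the Bochner
      integral is 0 and the bound is trivial, so no null set of \<open>y\<close> has to be
      excluded.\<close>
    have "ennreal (norm (\<integral>x. F x y \<partial>M1)) \<le> (\<integral>\<^sup>+x. ennreal (norm (F x y)) \<partial>M1)"
      by (cases "integrable M1 (\<lambda>x. F x y)")
         (auto simp: integral_norm_bound_ennreal not_integrable_integral_eq)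
    also have "\<dots> = (\<integral>\<^sup>+x. ennreal (norm (F x y) / sqrt (w x)) * ennreal (sqrt (w x)) \<partial>M1)"
      by (intro nn_integral_cong) (use w_pos in \<open>fastforce simp: less_imp_le ennreal_mult'[symmetric]\<close>)
    finally have "ennreal (norm (\<integral>x. F x y \<partial>M1)) ^ 2
        \<le> (\<integral>\<^sup>+x. ennreal (norm (F x y) / sqrt (w x)) * ennreal (sqrt (w x)) \<partial>M1) ^ 2"
      by (rule power_mono) simp
    also have "\<dots> \<le> (\<integral>\<^sup>+x. ennreal (norm (F x y) / sqrt (w x)) ^ 2 \<partial>M1) * (\<integral>\<^sup>+x. ennreal (sqrt (w x)) ^ 2 \<partial>M1)"
      by (rule Cauchy_Schwarz_nn_integral) measurable
    also have "(\<integral>\<^sup>+x. ennreal (norm (F x y) / sqrt (w x)) ^ 2 \<partial>M1) = (\<integral>\<^sup>+x. ennreal ((norm (F x y))\<^sup>2 / w x) \<partial>M1)"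
      by (intro nn_integral_cong) (use w_pos in \<open>auto simp: ennreal_power power_divide less_imp_le\<close>)
    also have "(\<integral>\<^sup>+x. ennreal (sqrt (w x)) ^ 2 \<partial>M1) = W"
      unfolding W_def by (intro nn_integral_cong) (use w_pos in \<open>auto simp: ennreal_power less_imp_le\<close>)
    finally show ?thesis by (simp add: ennreal_power)
  qed
  have "(\<integral>\<^sup>+y. ennreal ((norm (\<integral>x. F x y \<partial>M1))\<^sup>2) \<partial>M2)
      \<le> (\<integral>\<^sup>+y. (\<integral>\<^sup>+x. ennreal ((norm (F x y))\<^sup>2 / w x) \<partial>M1) * W \<partial>M2)"
    by (intro nn_integral_mono pointwise)
  also have "\<dots> = (\<integral>\<^sup>+y. (\<integral>\<^sup>+x. ennreal ((norm (F x y))\<^sup>2 / w x) \<partial>M1) \<partial>M2) * W"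
    by (rule nn_integral_multc) measurable
  also have "(\<integral>\<^sup>+y. (\<integral>\<^sup>+x. ennreal ((norm (F x y))\<^sup>2 / w x) \<partial>M1) \<partial>M2)
      = (\<integral>\<^sup>+x. (\<integral>\<^sup>+y. ennreal ((norm (F x y))\<^sup>2 / w x) \<partial>M2) \<partial>M1)"
    by (rule Fubini') measurable
  also have "\<dots> \<le> W"
    unfolding W_def
  proof (rule nn_integral_mono)
    fix x assume x: "x \<in> space M1"
    have [measurable]: "(\<lambda>y. F x y) \<in> borel_measurable M2"
      using measurable_compose[OF measurable_Pair1'[OF x] F] by simp
    have "(\<integral>\<^sup>+y. ennreal ((norm (F x y))\<^sup>2 / w x) \<partial>M2) = (\<integral>\<^sup>+y. ennreal (1 / w x) * ennreal ((norm (F x y))\<^sup>2) \<partial>M2)"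
      using w_pos[OF x] by (intro nn_integral_cong) (simp flip: ennreal_mult')
    also have "\<dots> = ennreal (1 / w x) * (\<integral>\<^sup>+y. ennreal ((norm (F x y))\<^sup>2) \<partial>M2)"
      by (rule nn_integral_cmult) measurable
    also have "\<dots> \<le> ennreal (1 / w x) * ennreal ((w x)\<^sup>2)"
      by (intro mult_left_mono F_le x) simp
    also have "\<dots> = ennreal (w x)"
      using w_pos[OF x] by (simp add: power2_eq_square flip: ennreal_mult')
    finally show "(\<integral>\<^sup>+y. ennreal ((norm (F x y))\<^sup>2 / w x) \<partial>M2) \<le> ennreal (w x)" .
  qed
  finally show ?thesis
    by (simp add: W_def power2_eq_square mult_right_mono)
qed

section \<open>Gaussian bounds at the saddle point\<close>

text \<open>A multiple of the normal density with variance \<open>1 / (2 * c)\<close>. The value is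
  independent of the centre \<open>\<mu>\<close>, which will move with \<open>N\<close>.\<close>

lemma nn_integral_gaussian:
  assumes c: "c > 0"
  shows "(\<integral>\<^sup>+y. ennreal (exp (- c * (y - \<mu>)\<^sup>2)) \<partial>lborel) = ennreal (sqrt (pi / c))"
proof -
  have "exp (- c * (y - \<mu>)\<^sup>2) = sqrt (pi / c) * normal_density \<mu> (sqrt (1 / (2 * c))) y" for y
    using c by (simp add: normal_density_def field_simps)
  then have "(\<integral>\<^sup>+y. ennreal (exp (- c * (y - \<mu>)\<^sup>2)) \<partial>lborel)
      = ennreal (\<integral>y. sqrt (pi / c) * normal_density \<mu> (sqrt (1 / (2 * c))) y \<partial>lborel)"
    using c by (simp only:) (intro nn_integral_eq_integral, auto)
  then show ?thesis using c by simp
qed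

text \<open>For \<open>d = 0\<close> the exponent is
  \<open>- \<gamma> * (y\<^sup>2 + K / y\<^sup>2)\<close>, with maximum
  \<open>- 2 * \<gamma> * sqrt K\<close> at \<open>y = sqrt (sqrt K)\<close>. The correction by
  \<open>d\<close> is large only for small \<open>y\<close>, where there is room to spare. The
  region far below the saddle point and its complement contribute one Gaussian each.\<close>

lemma saddle_point_bound:
  fixes \<gamma> d \<beta> K y :: real
  assumes pos: "\<gamma> > 0" "d > 0" "K > 0" "y > 0" and d: "d < \<beta>" and y: "\<beta> \<le> y\<^sup>2"
  defines "\<kappa> \<equiv> 1 - d / \<beta>"
  shows "exp (- \<gamma> * y\<^sup>2 - K * \<gamma> * (1 / y\<^sup>2 - d / y ^ 4))
       \<le> exp (- 2 * \<gamma> * sqrt K)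
          * (exp (- \<gamma> * y\<^sup>2) + exp (4 * \<gamma> * d / \<kappa>\<^sup>2) * exp (- \<gamma> * (y - sqrt (sqrt K))\<^sup>2))"
proof -
  have \<kappa>: "\<kappa> > 0" using pos d by (simp add: \<kappa>_def)
  have y2: "y\<^sup>2 > 0" using pos by simp
  have y4: "y ^ 4 = y\<^sup>2 * y\<^sup>2" by (simp flip: power_add)
  define r where "r = sqrt (sqrt K)"
  have r: "r > 0" "r\<^sup>2 = sqrt K" "r\<^sup>2 * r\<^sup>2 = K" using pos by (auto simp: r_def)
  show ?thesis
  proof (cases "y\<^sup>2 \<le> \<kappa> * sqrt K / 2")
    case True
    \<comment> \<open>Far below the saddle point the term with \<open>K\<close> alone supplies
      \<open>2 * sqrt K\<close>, and \<open>exp (- \<gamma> * y\<^sup>2)\<close> is kept as the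
      first Gaussian.\<close>
    have "d / y\<^sup>2 \<le> d / \<beta>"
      using pos d y by (intro divide_left_mono) auto
    then have k1: "1 - d / y\<^sup>2 \<ge> \<kappa>" by (simp add: \<kappa>_def)
    have "2 * sqrt K * y\<^sup>2 \<le> 2 * sqrt K * (\<kappa> * sqrt K / 2)"
      using pos by (intro mult_left_mono True) auto
    also have "\<dots> = K * \<kappa>" using pos by simp
    also have "\<dots> \<le> K * (1 - d / y\<^sup>2)" using pos by (intro mult_left_mono k1) auto
    finally have "2 * sqrt K \<le> K * (1 - d / y\<^sup>2) / y\<^sup>2"
      using y2 by (simp add: pos_le_divide_eq)
    also have "\<dots> = K * (1 / y\<^sup>2 - d / y ^ 4)"
      using y2 unfolding y4 by (simp add: field_simps)
    finally have "2 * \<gamma> * sqrt K \<le> K * \<gamma> * (1 / y\<^sup>2 - d / y ^ 4)"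
      using mult_left_mono[of _ _ \<gamma>] pos by (fastforce simp: mult_ac)
    then have "exp (- \<gamma> * y\<^sup>2 - K * \<gamma> * (1 / y\<^sup>2 - d / y ^ 4)) \<le> exp (- 2 * \<gamma> * sqrt K + - \<gamma> * y\<^sup>2)"
      by simp
    also have "\<dots> = exp (- 2 * \<gamma> * sqrt K) * exp (- \<gamma> * y\<^sup>2)" by (rule exp_add)
    also have "\<dots> \<le> exp (- 2 * \<gamma> * sqrt K)
          * (exp (- \<gamma> * y\<^sup>2) + exp (4 * \<gamma> * d / \<kappa>\<^sup>2) * exp (- \<gamma> * (y - sqrt (sqrt K))\<^sup>2))"
      by (intro mult_left_mono) auto
    finally show ?thesis .
  next
    case False
    \<comment> \<open>Here \<open>y ^ 4\<close> is at least \<open>K * \<kappa>\<^sup>2 / 4\<close>,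
      so the correction costs a constant factor that is independent of \<open>K\<close>.\<close>
    have "(\<kappa> * sqrt K / 2)\<^sup>2 \<le> (y\<^sup>2)\<^sup>2"
      using False pos \<kappa> by (intro power_mono) auto
    then have "K * \<kappa>\<^sup>2 \<le> 4 * y ^ 4"
      using pos by (simp add: power_mult_distrib power_divide mult.commute)
    then have "K * d / y ^ 4 \<le> 4 * d / \<kappa>\<^sup>2"
      using pos \<kappa> mult_left_mono[of "K * \<kappa>\<^sup>2" "4 * y ^ 4" d] by (simp add: field_simps)
    moreover have "2 * sqrt K + (y - r)\<^sup>2 \<le> y\<^sup>2 + K / y\<^sup>2"
    proof -
      \<comment> \<open>The excess over the minimum is the square of
        \<open>y - r\<^sup>2 / y = (y - r) * ((y + r) / y)\<close>, whose last factor is at least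
        1.\<close>
      have "(y - r)\<^sup>2 * 1 \<le> (y - r)\<^sup>2 * ((y + r) / y)\<^sup>2"
        using pos r by (intro mult_left_mono) (auto simp: field_simps)
      also have "\<dots> = (y - r\<^sup>2 / y)\<^sup>2"
        using pos by (simp add: power2_eq_square field_simps)
      also have "\<dots> = y\<^sup>2 + (r\<^sup>2 * r\<^sup>2) / y\<^sup>2 - 2 * r\<^sup>2"
        using pos by (simp add: power2_eq_square field_simps)
      also have "\<dots> = y\<^sup>2 + K / y\<^sup>2 - 2 * sqrt K"
        by (simp only: r(3)) (simp only: r(2))
      finally show ?thesis by simp
    qed
    ultimately have "2 * sqrt K + (y - r)\<^sup>2 - 4 * d / \<kappa>\<^sup>2 \<le> y\<^sup>2 + K * (1 / y\<^sup>2 - d / y ^ 4)"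
      by (simp add: right_diff_distrib)
    then have "\<gamma> * (2 * sqrt K + (y - r)\<^sup>2 - 4 * d / \<kappa>\<^sup>2) \<le> \<gamma> * (y\<^sup>2 + K * (1 / y\<^sup>2 - d / y ^ 4))"
      using pos by (intro mult_left_mono) auto
    then have "exp (- \<gamma> * y\<^sup>2 - K * \<gamma> * (1 / y\<^sup>2 - d / y ^ 4))
        \<le> exp (- 2 * \<gamma> * sqrt K + (4 * \<gamma> * d / \<kappa>\<^sup>2 + - \<gamma> * (y - r)\<^sup>2))"
      by (simp add: algebra_simps)
    also have "\<dots> = exp (- 2 * \<gamma> * sqrt K) * (exp (4 * \<gamma> * d / \<kappa>\<^sup>2) * exp (- \<gamma> * (y - r)\<^sup>2))"
      by (simp only: exp_add)
    also have "\<dots> \<le> exp (- 2 * \<gamma> * sqrt K)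
          * (exp (- \<gamma> * y\<^sup>2) + exp (4 * \<gamma> * d / \<kappa>\<^sup>2) * exp (- \<gamma> * (y - sqrt (sqrt K))\<^sup>2))"
      unfolding r_def by (intro mult_left_mono) auto
    finally show ?thesis .
  qed
qed


section \<open>Laguerre approximation of superpositions of exponentials\<close>

text \<open>\<open>1 + x \<le> exp x\<close>, applied to the squared modulus, moves the power into
  an exponent that can be combined with the decay of the weight.\<close>

lemma cayley_power_le:
  assumes s: "Re s > 0"
  shows "cmod ((s - 1) / (s + 1)) ^ n \<le> exp (- (2 * real n * Re s / (cmod (s + 1))\<^sup>2))"
proof -
  let ?q = "cmod ((s - 1) / (s + 1))"
  have "?q\<^sup>2 \<le> exp (- (4 * Re s / (cmod (s + 1))\<^sup>2))"
    unfolding cmod_cayley_square[OF s] using exp_ge_add_one_self[of "- (4 * Re s / (cmod (s + 1))\<^sup>2)"] by simp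
  also have "\<dots> = (exp (- 2 * Re s / (cmod (s + 1))\<^sup>2))\<^sup>2"
    by (simp flip: exp_double)
  finally have "?q \<le> exp (- 2 * Re s / (cmod (s + 1))\<^sup>2)"
    by (rule power2_le_imp_le) simp
  then have "?q ^ n \<le> exp (- 2 * Re s / (cmod (s + 1))\<^sup>2) ^ n"
    by (intro power_mono) auto
  then show ?thesis by (simp add: mult_ac flip: exp_of_nat_mult)
qed

text \<open>By linearity, superposing the truncated expansions gives an element of
  \<open>laguerre_space N\<close>, and its error is the superposition of the errors; Minkowski's
  inequality adds up their norms. Bounds along \<open>s\<close> are demanded only where
  \<open>G\<close> does not vanish, but \<open>w\<close> is positive everywhere since Minkowski's
  inequality divides by it.\<close>

lemma laguerre_approx_of_exp_superposition:
  fixes s G :: "real \<Rightarrow> complex" and f :: "real \<Rightarrow> complex"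
  assumes s [measurable]: "s \<in> borel_measurable borel"
    and G: "integrable lborel G" and s_pos: "\<And>y. G y \<noteq> 0 \<Longrightarrow> Re (s y) > 0"
    and w [measurable]: "w \<in> borel_measurable borel" and w_pos: "\<And>y. w y > 0"
    and w_ge: "\<And>y. G y \<noteq> 0 \<Longrightarrow>
      cmod (G y) * cmod ((s y - 1) / (s y + 1)) ^ (N + 1) / sqrt (2 * Re (s y)) \<le> w y"
    and W: "(\<integral>\<^sup>+y. ennreal (w y) \<partial>lborel) \<le> ennreal W" "W \<ge> 0"
    and f: "\<And>x. x \<ge> 0 \<Longrightarrow> has_bochner_integral lborel (\<lambda>y. G y * exp (- s y * of_real x)) (f x)"
  shows "\<exists>u \<in> laguerre_space N. L2_norm_halfline (\<lambda>x. f x - u x) \<le> W"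
proof -
  have [measurable]: "G \<in> borel_measurable borel" using G by auto
  have [measurable]: "laguerre_fun n \<in> borel_measurable borel" for n
    unfolding laguerre_fun_def laguerre_poly_def by measurable
  have cm [measurable]: "(\<lambda>y. laguerre_exp_coeff (s y) n) \<in> borel_measurable borel" for n
    unfolding laguerre_exp_coeff_def by measurable
  define F where "F = (\<lambda>y x. G y * laguerre_exp_error N (s y) x)"
  have F: "(\<lambda>(y, x). F y x) \<in> borel_measurable (borel \<Otimes>\<^sub>M borel)"
    unfolding F_def laguerre_exp_error_def by measurable
  \<comment> \<open>The identity as a measurable map into the Borel product carries joint
    measurability over to the product with \<open>halfline\<close>.\<close>
  have "(\<lambda>z. (fst z, snd z)) \<in> lborel \<Otimes>\<^sub>M halfline \<rightarrow>\<^sub>M borel \<Otimes>\<^sub>M borel"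
    by (intro measurable_Pair measurable_compose[OF measurable_snd measurable_restrict_space1]) auto
  from measurable_compose[OF this F]
  have F': "(\<lambda>(y, x). F y x) \<in> borel_measurable (lborel \<Otimes>\<^sub>M halfline)"
    by (simp add: case_prod_beta')
  have sf: "sigma_finite_measure halfline"
    by (intro sigma_finite_measure_restrict_space sigma_finite_lborel) auto
  \<comment> \<open>In the right half-plane \<open>s + 1\<close> has modulus at least 1 and the
    Cayley factor at most 1, so \<open>2 * G\<close> dominates and the coefficients
    \<open>c n\<close> exist as integrals.\<close>
  have coeff_le: "norm (G y * laguerre_exp_coeff (s y) n) \<le> norm (2 * G y)" for y n
  proof (cases "G y = 0")
    case False
    then have pos: "Re (s y) > 0" by (rule s_pos)
    have "1 \<le> cmod (s y + 1)"
      using complex_Re_le_cmod[of "s y + 1"] pos by simp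
    moreover have "cmod ((s y - 1) / (s y + 1)) ^ n \<le> 1"
      using cayley_power_le[OF pos, of n] pos by (intro order_trans[OF cayley_power_le[OF pos]]) auto
    ultimately have "cmod (laguerre_exp_coeff (s y) n) \<le> 2 * 1"
      unfolding laguerre_exp_coeff_def norm_mult norm_power
      by (intro mult_mono) (auto simp: norm_divide intro!: divide_le_eq[THEN iffD2])
    then show ?thesis
      using mult_left_mono[of _ 2 "cmod (G y)"] by (simp add: norm_mult mult.commute[of 2])
  qed auto
  have int_coeff: "integrable lborel (\<lambda>y. G y * laguerre_exp_coeff (s y) n)" for n
    by (rule Bochner_Integration.integrable_bound[of _ "\<lambda>y. 2 * G y"]) (use G coeff_le in auto)
  define c where "c = (\<lambda>n. \<integral>y. G y * laguerre_exp_coeff (s y) n \<partial>lborel)"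
  define u where "u = (\<lambda>x. \<Sum>n\<le>N. c n * of_real (laguerre_fun n x))"
  have error: "f x - u x = (\<integral>y. F y x \<partial>lborel)" if "x \<ge> 0" for x
  proof -
    have "has_bochner_integral lborel
        (\<lambda>y. G y * exp (- s y * of_real x) - (\<Sum>n\<le>N. G y * laguerre_exp_coeff (s y) n * of_real (laguerre_fun n x)))
        (f x - u x)"
      unfolding u_def c_def
      by (intro has_bochner_integral_diff f that has_bochner_integral_sum has_bochner_integral_mult_left
                has_bochner_integral_integrable int_coeff)
    moreover have "G y * exp (- s y * of_real x) - (\<Sum>n\<le>N. G y * laguerre_exp_coeff (s y) n * of_real (laguerre_fun n x))
        = F y x" for y
      by (simp add: F_def laguerre_exp_error_def right_diff_distrib sum_distrib_left mult.assoc)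
    ultimately show ?thesis
      by (simp add: has_bochner_integral_iff)
  qed
  have F_le: "(\<integral>\<^sup>+x. ennreal ((cmod (F y x))\<^sup>2) \<partial>halfline) \<le> ennreal ((w y)\<^sup>2)" for y
  proof (cases "G y = 0")
    case False
    let ?q = "cmod ((s y - 1) / (s y + 1))"
    have pos: "Re (s y) > 0" by (rule s_pos[OF False])
    have "has_bochner_integral halfline (\<lambda>x. (cmod (G y))\<^sup>2 * (cmod (laguerre_exp_error N (s y) x))\<^sup>2)
        ((cmod (G y))\<^sup>2 * (?q ^ (2 * (N + 1)) / (2 * Re (s y))))"
      by (intro has_bochner_integral_mult_right has_bochner_integral_laguerre_exp_error pos)
    then have "(\<integral>\<^sup>+x. ennreal ((cmod (F y x))\<^sup>2) \<partial>halfline)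
        = ennreal ((cmod (G y))\<^sup>2 * (?q ^ (2 * (N + 1)) / (2 * Re (s y))))"
      by (subst nn_integral_eq_integral)
         (auto simp: F_def norm_mult power_mult_distrib has_bochner_integral_iff)
    also have "(cmod (G y))\<^sup>2 * (?q ^ (2 * (N + 1)) / (2 * Re (s y)))
        = (cmod (G y) * ?q ^ (N + 1) / sqrt (2 * Re (s y)))\<^sup>2"
      unfolding mult.commute[of 2 "N + 1"] power_mult
      using pos by (simp add: power_mult_distrib power_divide)
    also have "ennreal \<dots> \<le> ennreal ((w y)\<^sup>2)"
      using w_ge[OF False] pos by (intro ennreal_leI power_mono) auto
    finally show ?thesis .
  qed (simp add: F_def)
  have "(\<integral>\<^sup>+x. ennreal ((cmod (\<integral>y. F y x \<partial>lborel))\<^sup>2) \<partial>halfline) \<le> (\<integral>\<^sup>+y. ennreal (w y) \<partial>lborel)\<^sup>2"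
    by (rule minkowski_integral_inequality[OF sigma_finite_lborel sf F'])
       (use w_pos F_le in auto)
  also have "\<dots> \<le> (ennreal W)\<^sup>2" by (intro power_mono W) simp
  also have "\<dots> = ennreal (W\<^sup>2)" using W by (simp add: ennreal_power)
  finally have nn: "(\<integral>\<^sup>+x. ennreal ((cmod (\<integral>y. F y x \<partial>lborel))\<^sup>2) \<partial>halfline) \<le> ennreal (W\<^sup>2)" .
  have km: "(\<lambda>x. \<integral>y. F y x \<partial>lborel) \<in> borel_measurable borel"
    using F by measurable
  \<comment> \<open>\<open>f\<close> is prescribed only for \<open>x \<ge> 0\<close>. The integral
    that replaces the error is Borel measurable on the whole line, which permits the passage from
    \<open>lebesgue\<close> to \<open>lborel\<close>.\<close>
  have "(LINT x:{0..}|lebesgue. (cmod (f x - u x))\<^sup>2) = (LINT x:{0..}|lebesgue. (cmod (\<integral>y. F y x \<partial>lborel))\<^sup>2)"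
    by (intro set_lebesgue_integral_cong) (auto simp: error)
  also have "\<dots> = (LINT x:{0..}|lborel. (cmod (\<integral>y. F y x \<partial>lborel))\<^sup>2)"
    unfolding set_lebesgue_integral_def 
    by (intro integral_completion borel_measurable_scaleR borel_measurable_indicator
              borel_measurable_power borel_measurable_norm) (use km in simp_all)
  also have "\<dots> = (\<integral>x. (cmod (\<integral>y. F y x \<partial>lborel))\<^sup>2 \<partial>halfline)"
    by (simp add: integral_restrict_space set_lebesgue_integral_def)
  also have "\<dots> = enn2real (\<integral>\<^sup>+x. ennreal ((cmod (\<integral>y. F y x \<partial>lborel))\<^sup>2) \<partial>halfline)"
    by (intro integral_eq_nn_integral measurable_restrict_space1 borel_measurable_power
              borel_measurable_norm AE_I2) (use km in simp_all)
  also have "\<dots> \<le> W\<^sup>2"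
    using nn by (intro enn2real_leI) auto
  finally have "L2_norm_halfline (\<lambda>x. f x - u x) \<le> W"
    unfolding L2_norm_halfline_def using W by (intro real_le_lsqrt) auto
  moreover have "u \<in> laguerre_space N"
    unfolding laguerre_space_def u_def by blast
  ultimately show ?thesis by blast
qed

section \<open>The Hankel function on the ray of steepest descent\<close>

text \<open>The substitution \<open>t = y\<^sup>2 - \<beta>\<close> in the integral of
  \<open>exp (- t * w)\<close> over the half-line, carried out through the antiderivative.\<close>

lemma has_bochner_integral_square_exp:
  fixes w :: complex
  assumes w: "Re w > 0" and \<beta>: "\<beta> \<ge> 0"
  shows "has_bochner_integral lborel
           (\<lambda>y. indicator {sqrt \<beta>..} y *\<^sub>R (of_real (2 * y) * exp (- of_real (y\<^sup>2 - \<beta>) * w))) (1 / w)"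
proof -
  have w0: "w \<noteq> 0" using w by auto
  let ?f = "\<lambda>y. complex_of_real (2 * y) * exp (- of_real (y\<^sup>2 - \<beta>) * w)"
  let ?F = "\<lambda>y. - exp (- complex_of_real (y\<^sup>2 - \<beta>) * w) / w"
  let ?g = "\<lambda>y. 2 * y * exp (- (y\<^sup>2 - \<beta>) * Re w)"
  let ?G = "\<lambda>y. - exp (- (y\<^sup>2 - \<beta>) * Re w) / Re w"
  have lim: "((\<lambda>y. exp (- (y\<^sup>2 - \<beta>) * Re w)) \<longlongrightarrow> 0) at_top"
    using w by real_asymp
  have "has_bochner_integral lborel (\<lambda>y. indicator {sqrt \<beta>..} y *\<^sub>R ?f y) (- ?F (sqrt \<beta>))"
  proof (rule has_bochner_integral_FTC_Ici[where C = 1 and g = ?g and G = ?G and T = "- 0 / Re w"])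
    show "(?F has_vector_derivative ?f y) (at y)" for y
      using w0 by (auto intro!: derivative_eq_intros has_vector_derivative_real_field)
    show "(?F \<longlongrightarrow> 0) at_top"
    proof (rule Lim_null_comparison)
      show "\<forall>\<^sub>F y in at_top. norm (?F y) \<le> exp (- (y\<^sup>2 - \<beta>) * Re w) * (1 / cmod w)"
        by (simp add: norm_divide)
      show "((\<lambda>y. exp (- (y\<^sup>2 - \<beta>) * Re w) * (1 / cmod w)) \<longlongrightarrow> 0) at_top"
        by (rule tendsto_mult_left_zero[OF lim])
    qed
    fix y :: real assume "sqrt \<beta> \<le> y"
    then have y: "y \<ge> 0" using \<beta> real_sqrt_ge_zero order_trans by blast
    then show "cmod (?f y) \<le> 1 * ?g y" "0 \<le> ?g y" by (auto simp: norm_mult)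
    show "(?G has_real_derivative ?g y) (at y)"
      using w by (auto intro!: derivative_eq_intros)
  next
    show "(?G \<longlongrightarrow> - 0 / Re w) at_top"
      using w by (intro tendsto_divide tendsto_minus lim tendsto_const) auto
  qed (auto intro!: continuous_intros)
  then show ?thesis using \<beta> by simp
qed

theorem theorem5p12:
  fixes R :: real and \<omega> \<sigma> :: complex
  assumes "R > 0" and "Im \<sigma> > 0" and "Im (\<sigma> * \<omega>) > 0"
  shows "\<exists>c\<^sub>1 c\<^sub>2 :: real. c\<^sub>1 > 0 \<and> c\<^sub>2 > 0 \<and>
    (\<forall>N :: nat. N \<ge> 1 \<longrightarrow>
      (INF u \<in> laguerre_space N.
         L2_norm_halfline
           (\<lambda>\<xi>. spherical_hankel0 (\<omega> * (complex_of_real R + \<sigma> * complex_of_real \<xi>)) - u \<xi>))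
      \<le> c\<^sub>1 * cmod ((1 + \<i> * \<sigma> * \<omega>) / (1 - \<i> * \<sigma> * \<omega>)) ^ (N + 1)
        + c\<^sub>2 * exp (- 2 * Re (csqrt (2 * complex_of_real R * of_nat (N + 1) / \<sigma>))))"
proof -
  define p where "p = - (\<i> * \<sigma> * \<omega>)"
  define \<rho> where "\<rho> = complex_of_real R / \<sigma>"
  define g where "g = csqrt \<rho>"
  define \<gamma> where "\<gamma> = Re g"
  define m where "m = (cmod g)\<^sup>2"
  have nz: "\<sigma> \<noteq> 0" "\<omega> \<noteq> 0" using assms by auto
  \<comment> \<open>\<open>\<rho>\<close> lies off the branch cut, so its principal root has
    strictly positive real part \<open>\<gamma>\<close>, the decay rate of the Gaussians.\<close>
  have "Im \<rho> < 0"
    using assms nz by (simp add: \<rho>_def Im_divide divide_neg_pos cmod_power2[symmetric])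
  moreover have gg: "g * g = \<rho>"
    unfolding g_def by (simp only: flip: power2_eq_square) (rule power2_csqrt)
  then have "Im \<rho> = 2 * (Re g * Im g)"
    by (metis mult_2 mult.commute times_complex.sel(2))
  ultimately have "Re g \<noteq> 0" by force
  then have \<gamma>: "\<gamma> > 0"
    using csqrt_principal[of \<rho>] unfolding \<gamma>_def g_def by linarith
  then have g: "g \<noteq> 0" "g * g = \<rho>" using gg by (auto simp: \<gamma>_def)
  have m: "m > 0" using g by (simp add: m_def)
  have p: "Re p > 0" using assms by (simp add: p_def)
  have Re_inv_g: "Re (of_real t / g) = t * \<gamma> / m" for t
    by (simp add: Re_divide \<gamma>_def m_def cmod_power2)
  \<comment> \<open>\<open>\<beta>\<close> absorbs \<open>Re p\<close>, so that
    \<open>Re (s y)\<close> is exactly \<open>\<gamma> * (y\<^sup>2 - d) / m\<close>;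
    \<open>d\<close> absorbs \<open>p + 1\<close>, so that
    \<open>cmod (s y + 1) \<le> y\<^sup>2 / cmod g\<close>. As \<open>d < \<beta>\<close>, the ray,
    which leaves \<open>p\<close> at \<open>y = sqrt \<beta>\<close>, stays in the right
    half-plane.\<close>
  define d where "d = cmod g * cmod (p + 1)"
  define \<beta> where "\<beta> = d + Re p * m / \<gamma>"
  define \<kappa> where "\<kappa> = 1 - d / \<beta>"
  have "p + 1 \<noteq> 0" using p by (auto simp: complex_eq_iff)
  then have d: "d > 0" using g by (simp add: d_def)
  have \<beta>: "d < \<beta>" using p m \<gamma> by (simp add: \<beta>_def)
  have \<kappa>: "\<kappa> > 0" using d \<beta> by (simp add: \<kappa>_def)
  define s where "s = (\<lambda>y. p + complex_of_real (y\<^sup>2 - \<beta>) / g)"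
  \<comment> \<open>With this constant the function to be approximated is
    \<open>C * exp (- p * x) / (x + \<rho>)\<close>.\<close>
  define C where "C = - \<i> * exp (\<i> * \<omega> * of_real R) / (\<omega> * \<sigma>)"
  \<comment> \<open>\<open>2 * y\<close> is the derivative of \<open>y\<^sup>2\<close>, and
    \<open>(s y - p) * \<rho> = (y\<^sup>2 - \<beta>) * g\<close> because
    \<open>g * g = \<rho>\<close>.\<close>
  define G where "G = (\<lambda>y. indicator {sqrt \<beta>..} y *\<^sub>R (C / g * (of_real (2 * y) * exp (- of_real (y\<^sup>2 - \<beta>) * g))))"
  have C: "C \<noteq> 0" using nz by (simp add: C_def)
  have G_nz: "y > 0" "y\<^sup>2 \<ge> \<beta>" if "G y \<noteq> 0" for y
  proof -
    have *: "sqrt \<beta> \<le> y" using that by (auto simp: G_def indicator_def split: if_splits)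
    show "y > 0" using * d \<beta> real_sqrt_gt_zero[of \<beta>] by linarith
    show "y\<^sup>2 \<ge> \<beta>" using * d \<beta> by (simp add: sqrt_le_D)
  qed
  have Re_s: "Re (s y) = \<gamma> * (y\<^sup>2 - d) / m" for y
    unfolding s_def plus_complex.sel Re_inv_g using \<gamma> m by (simp add: \<beta>_def field_simps)
  have Re_s_ge: "Re (s y) \<ge> \<gamma> * \<kappa> * y\<^sup>2 / m" if "y\<^sup>2 \<ge> \<beta>" for y
  proof -
    have "d * \<beta> \<le> d * y\<^sup>2" using that d by simp
    then have "\<kappa> * y\<^sup>2 \<le> y\<^sup>2 - d" using d \<beta> by (simp add: \<kappa>_def field_simps)
    then show ?thesis unfolding Re_s mult.assoc using \<gamma> m by (intro divide_right_mono mult_left_mono) auto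
  qed
  have s_pos: "Re (s y) > 0" if "G y \<noteq> 0" for y
    unfolding Re_s using G_nz[OF that] \<beta> \<gamma> m by simp
  have s_le: "cmod (s y + 1) \<le> y\<^sup>2 / cmod g" if "y\<^sup>2 \<ge> \<beta>" for y
  proof -
    have "cmod (s y + 1) \<le> cmod (p + 1) + cmod (of_real (y\<^sup>2 - \<beta>) / g)"
      using norm_triangle_ineq[of "p + 1" "of_real (y\<^sup>2 - \<beta>) / g"]
      by (simp only: s_def add_ac)
    also have "cmod (of_real (y\<^sup>2 - \<beta>) / g) = (y\<^sup>2 - \<beta>) / cmod g"
      using that by (simp only: norm_divide norm_of_real)
    also have "cmod (p + 1) = d / cmod g" using g by (simp add: d_def)
    also have "d / cmod g + (y\<^sup>2 - \<beta>) / cmod g \<le> y\<^sup>2 / cmod g"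
      using \<beta> g by (simp add: add_divide_distrib[symmetric] divide_right_mono)
    finally show ?thesis .
  qed
  \<comment> \<open>\<open>K0\<close> collects the constants of
    \<open>cmod (G y) / sqrt (2 * Re (s y))\<close>, \<open>K1\<close> is the loss in
    \<open>saddle_point_bound\<close>, and \<open>c2\<close> adds the integrals of the two
    Gaussians.\<close>
  define K0 where "K0 = 2 * cmod C / cmod g * sqrt (m / (2 * \<gamma> * \<kappa>)) * exp (\<beta> * \<gamma>)"
  define K1 where "K1 = exp (4 * \<gamma> * d / \<kappa>\<^sup>2)"
  define c2 where "c2 = K0 * (1 + K1) * sqrt (pi / \<gamma>)"
  have K: "K0 > 0" "K1 > 0" using C g m \<gamma> \<kappa> by (auto simp: K0_def K1_def)
  then have c2: "c2 > 0" using \<gamma> by (auto simp: c2_def intro!: mult_pos_pos add_pos_pos)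
  define f where "f = (\<lambda>x. spherical_hankel0 (\<omega> * (complex_of_real R + \<sigma> * complex_of_real x)))"
  have f: "has_bochner_integral lborel (\<lambda>y. G y * exp (- s y * of_real x)) (f x)" if x: "x \<ge> 0" for x
  proof -
    \<comment> \<open>The exponents at \<open>x\<close> and in the weight combine to
      \<open>- p * x - (y\<^sup>2 - \<beta>) * w\<close>, and \<open>w * g = x + \<rho>\<close> is
      the denominator sought.\<close>
    define w where "w = complex_of_real x / g + g"
    have w: "Re w > 0" using x \<gamma> m by (simp add: w_def Re_inv_g flip: \<gamma>_def) (simp add: add_nonneg_pos)
    then have "w \<noteq> 0" by auto
    have "w * g = of_real x + \<rho>" using g by (simp add: w_def field_simps)
    then have wg: "w * (g * \<sigma>) = of_real R + \<sigma> * of_real x" using nz by (simp add: \<rho>_def field_simps)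
    have "has_bochner_integral lborel
        (\<lambda>y. C / g * exp (- p * of_real x) * (indicator {sqrt \<beta>..} y *\<^sub>R (of_real (2 * y) * exp (- of_real (y\<^sup>2 - \<beta>) * w))))
        (C / g * exp (- p * of_real x) * (1 / w))"
      by (intro has_bochner_integral_mult_right has_bochner_integral_square_exp w) (use d \<beta> in simp)
    moreover have "C / g * exp (- p * of_real x) * (indicator {sqrt \<beta>..} y *\<^sub>R (of_real (2 * y) * exp (- of_real (y\<^sup>2 - \<beta>) * w)))
        = G y * exp (- s y * of_real x)" for y
    proof -
      have "exp (- p * of_real x) * exp (- of_real (y\<^sup>2 - \<beta>) * w)
          = exp (- of_real (y\<^sup>2 - \<beta>) * g) * exp (- s y * of_real x)"
        unfolding exp_add[symmetric] w_def s_def by (simp add: algebra_simps diff_divide_distrib)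
      then show ?thesis by (simp add: G_def)
    qed
    moreover have "C / g * exp (- p * of_real x) * (1 / w) = f x"
    proof -
      have "exp (\<i> * \<omega> * of_real R) * exp (- p * of_real x)
          = exp (\<i> * (\<omega> * (of_real R + \<sigma> * of_real x)))"
        by (simp add: p_def algebra_simps flip: exp_add)
      then show ?thesis
        using \<open>w \<noteq> 0\<close> g nz unfolding f_def spherical_hankel0_def wg[symmetric] C_def
        by (simp add: field_simps)
    qed
    ultimately show ?thesis by simp
  qed
  have G_int: "integrable lborel G"
  proof -
    have "Re g > 0" "\<beta> \<ge> 0" using \<gamma> d \<beta> by (auto simp: \<gamma>_def)
    from has_bochner_integral_mult_right[OF has_bochner_integral_square_exp[OF this], of "C / g"]
    show ?thesis by (simp add: G_def has_bochner_integral_iff)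
  qed
  have main: "(INF u \<in> laguerre_space N. L2_norm_halfline (\<lambda>x. f x - u x))
      \<le> c2 * exp (- 2 * Re (csqrt (2 * complex_of_real R * of_nat (N + 1) / \<sigma>)))" for N
  proof -
    define K where "K = 2 * real (N + 1)"
    define E where "E = exp (- 2 * \<gamma> * sqrt K)"
    define w where "w = (\<lambda>y. K0 * E * (exp (- \<gamma> * y\<^sup>2) + K1 * exp (- \<gamma> * (y - sqrt (sqrt K))\<^sup>2)))"
    \<comment> \<open>A positive multiple of the principal root \<open>g\<close> is again principal,
      so the factor \<open>E\<close> of the saddle point is the exponential of the
      statement.\<close>
    have "csqrt (2 * complex_of_real R * of_nat (N + 1) / \<sigma>) = of_real (sqrt K) * g"
    proof (rule csqrt_unique)
      have "(of_real (sqrt K) * g)\<^sup>2 = of_real ((sqrt K)\<^sup>2) * (g * g)"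
        by (simp only: power2_eq_square of_real_mult mult_ac)
      then show "(of_real (sqrt K) * g)\<^sup>2 = 2 * complex_of_real R * of_nat (N + 1) / \<sigma>"
        by (simp add: g K_def \<rho>_def algebra_simps add_divide_distrib)
      show "0 < Re (of_real (sqrt K) * g) \<or> Re (of_real (sqrt K) * g) = 0 \<and> 0 \<le> Im (of_real (sqrt K) * g)"
        using \<gamma> by (simp add: \<gamma>_def K_def)
    qed
    then have E_eq: "exp (- 2 * Re (csqrt (2 * complex_of_real R * of_nat (N + 1) / \<sigma>))) = E"
      by (simp add: E_def \<gamma>_def mult_ac)
    have "\<exists>u \<in> laguerre_space N. L2_norm_halfline (\<lambda>x. f x - u x) \<le> c2 * E"
    proof (rule laguerre_approx_of_exp_superposition[OF _ G_int s_pos _ _ _ _ _ f])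
      show "s \<in> borel_measurable borel" unfolding s_def by measurable
      show "w \<in> borel_measurable borel" unfolding w_def by measurable
      show "w y > 0" for y unfolding w_def E_def using K by (intro mult_pos_pos add_pos_pos) auto
      show "c2 * E \<ge> 0" using c2 by (simp add: E_def)
      have "(\<integral>\<^sup>+y. ennreal (w y) \<partial>lborel)
          = (\<integral>\<^sup>+y. ennreal (K0 * E) * (ennreal (exp (- \<gamma> * (y - 0)\<^sup>2)) + ennreal K1 * ennreal (exp (- \<gamma> * (y - sqrt (sqrt K))\<^sup>2))) \<partial>lborel)"
        using K by (intro nn_integral_cong) (simp add: w_def E_def flip: ennreal_mult' ennreal_plus)
      also have "\<dots> = ennreal (K0 * E) * (ennreal (sqrt (pi / \<gamma>)) + ennreal K1 * ennreal (sqrt (pi / \<gamma>)))"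
        by (subst nn_integral_cmult, measurable, subst nn_integral_add, measurable, subst nn_integral_cmult, measurable)
           (simp only: nn_integral_gaussian[OF \<gamma>])
      also have "\<dots> = ennreal (c2 * E)"
        using K \<gamma> by (simp add: c2_def E_def algebra_simps flip: ennreal_mult' ennreal_plus)
      finally show "(\<integral>\<^sup>+y. ennreal (w y) \<partial>lborel) \<le> ennreal (c2 * E)" by simp
    next
      fix y assume Gy: "G y \<noteq> 0"
      note y = G_nz[OF Gy]
      let ?q = "cmod ((s y - 1) / (s y + 1))" and ?h = "1 / y\<^sup>2 - d / y ^ 4"
      have "s y + 1 \<noteq> 0" using s_pos[OF Gy] by (auto simp: complex_eq_iff)
      \<comment> \<open>Replacing \<open>cmod (s y + 1)\<close> by its bound
        \<open>y\<^sup>2 / cmod g\<close> makes the Cayley exponent explicit in \<open>y\<close>, in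
        the form that \<open>saddle_point_bound\<close> expects; \<open>m = (cmod g)\<^sup>2\<close>
        cancels.\<close>
      have "?h = (y\<^sup>2 - d) / (y\<^sup>2)\<^sup>2"
        using y by (simp add: field_simps power4_eq_xxxx power2_eq_square)
      then have "K * \<gamma> * ?h = K * Re (s y) / (y\<^sup>2 / cmod g)\<^sup>2"
        using m unfolding Re_s power_divide[of "y\<^sup>2"] m_def[symmetric] by simp
      also have "\<dots> \<le> K * Re (s y) / (cmod (s y + 1))\<^sup>2"
        using s_le[OF y(2)] s_pos[OF Gy] \<open>s y + 1 \<noteq> 0\<close>
        by (intro divide_left_mono power_mono mult_nonneg_nonneg mult_pos_pos) (auto simp: K_def)
      finally have q: "?q ^ (N + 1) \<le> exp (- (K * \<gamma> * ?h))"
        by (intro order_trans[OF cayley_power_le[OF s_pos[OF Gy]]]) (simp add: K_def)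
      \<comment> \<open>The factor \<open>1 / y\<close> obtained here cancels the \<open>y\<close>
        in \<open>cmod (G y)\<close>, so that only Gaussian factors are left and no power of
        \<open>N\<close> arises.\<close>
      have "sqrt (2 * \<gamma> * \<kappa> / m) * y = sqrt (2 * (\<gamma> * \<kappa> * y\<^sup>2 / m))"
        using y by (simp add: real_sqrt_mult real_sqrt_divide)
      also have "\<dots> \<le> sqrt (2 * Re (s y))"
        using Re_s_ge[OF y(2)] by simp
      finally have r: "1 / sqrt (2 * Re (s y)) \<le> 1 / (sqrt (2 * \<gamma> * \<kappa> / m) * y)"
        using y \<gamma> \<kappa> m by (intro divide_left_mono) (auto intro!: mult_pos_pos s_pos[OF Gy])
      have G_eq: "cmod (G y) = 2 * cmod C / cmod g * y * exp (\<beta> * \<gamma>) * exp (- \<gamma> * y\<^sup>2)"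
      proof -
        have "cmod (G y) = cmod C / cmod g * (2 * y * exp (- (y\<^sup>2 - \<beta>) * \<gamma>))"
          using Gy y by (auto simp: G_def norm_mult norm_divide \<gamma>_def indicator_def)
        also have "exp (- (y\<^sup>2 - \<beta>) * \<gamma>) = exp (\<beta> * \<gamma>) * exp (- \<gamma> * y\<^sup>2)"
          by (simp add: algebra_simps flip: exp_add)
        finally show ?thesis by simp
      qed
      have "cmod (G y) * ?q ^ (N + 1) / sqrt (2 * Re (s y)) = cmod (G y) * (?q ^ (N + 1) * (1 / sqrt (2 * Re (s y))))"
        by simp
      also have "\<dots> \<le> cmod (G y) * (exp (- (K * \<gamma> * ?h)) * (1 / (sqrt (2 * \<gamma> * \<kappa> / m) * y)))"
        using s_pos[OF Gy] by (intro mult_left_mono mult_mono q r) auto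
      also have "\<dots> = K0 * exp (- \<gamma> * y\<^sup>2 - K * \<gamma> * ?h)"
      proof -
        have "exp (- \<gamma> * y\<^sup>2 - K * \<gamma> * ?h) = exp (- \<gamma> * y\<^sup>2) * exp (- (K * \<gamma> * ?h))"
          by (simp flip: exp_add)
        then show ?thesis
          using y unfolding G_eq K0_def by (simp add: real_sqrt_divide)
      qed
      also have "\<dots> \<le> K0 * (E * (exp (- \<gamma> * y\<^sup>2) + K1 * exp (- \<gamma> * (y - sqrt (sqrt K))\<^sup>2)))"
        unfolding E_def K1_def \<kappa>_def using K y \<gamma> d \<beta>
        by (intro mult_left_mono saddle_point_bound) (auto simp: K_def)
      finally show "cmod (G y) * ?q ^ (N + 1) / sqrt (2 * Re (s y)) \<le> w y"
        by (simp add: w_def)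
    qed
    then obtain u where u: "u \<in> laguerre_space N" "L2_norm_halfline (\<lambda>x. f x - u x) \<le> c2 * E" by blast
    have "bdd_below ((\<lambda>u. L2_norm_halfline (\<lambda>x. f x - u x)) ` laguerre_space N)"
      by (intro bdd_belowI2[of _ 0]) (auto simp: L2_norm_halfline_def set_lebesgue_integral_def intro!: integral_nonneg_AE)
    from cINF_lower[OF this u(1)] u(2) show ?thesis
      unfolding E_eq by (rule order_trans)
  qed
  \<comment> \<open>\<open>main\<close> bounds the infimum by the second term; the first,
    nonnegative, is added with \<open>c\<^sub>1 = 1\<close>.\<close>
  show ?thesis
  proof (rule exI[of _ 1], rule exI[of _ c2], intro conjI allI impI)
    fix N :: nat
    show "(INF u \<in> laguerre_space N. L2_norm_halfline
           (\<lambda>\<xi>. spherical_hankel0 (\<omega> * (complex_of_real R + \<sigma> * complex_of_real \<xi>)) - u \<xi>))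
      \<le> 1 * cmod ((1 + \<i> * \<sigma> * \<omega>) / (1 - \<i> * \<sigma> * \<omega>)) ^ (N + 1)
        + c2 * exp (- 2 * Re (csqrt (2 * complex_of_real R * of_nat (N + 1) / \<sigma>)))"
      by (intro order_trans[OF main[unfolded f_def]]) simp
  qed (use c2 in auto)
qed

end
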